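(* Let $S\subset\mathbb{R}^n$ be a closed set satisfying the extended exterior $r$-sphere condition for some $r>0$. Then $S^c$ is the union of closed $\frac{r}{2}$-balls.
   Context: $\mathbb{R}^n$ carries the standard inner product $\langle\cdot,\cdot\rangle$ and the Euclidean norm $\|\cdot\|$. $B(y;\rho)$ and $\bar B(y;\rho)$ denote the open and closed balls of radius $\rho>0$ centered at $y$; $S^c$ denotes the complement of $S$ in $\mathbb{R}^n$; $\operatorname{int}$, $\operatorname{bdry}$ denote interior and boundary. For a closed set $S\subset\mathbb{R}^n$ and $x\in S$, the proximal normal cone $N^P_S(x)$ is the set of all $\zeta\in\mathbb{R}^n$ for which there exists $\sigma\ge 0$ with $\langle \zeta,s-x\rangle\le\sigma\|s-x\|^2$ for all $s\in S$. A nonzero $\zeta\in N^P_S(x)$ is said to be realized by an $r$-sphere ($r>0$) if $B\left(x+r\frac{\zeta}{\|\zeta\|};r\right)\cap S=\emptyset$ (equivalently, $\left\langle \frac{\zeta}{\|\zeta\|},s-x\right\rangle\le\frac{1}{2r}\|s-x\|^2$ for all $s\in S$). A closed set $S$ satisfies the extended exterior $r$-sphere condition if both of the following hold: (1) for every $x\in\operatorname{bdry}(\operatorname{int}S)$ (which is a subset of $\operatorname{bdry}S$) there exists $0\neq\zeta\in N^P_S(x)$ that is realized by an $r$-sphere; (2) for every $x\in(\operatorname{bdry}S)\setminus\operatorname{bdry}(\operatorname{int}S)$, every $0\neq\zeta\in N^P_S(x)$ is realized by an $r$-sphere. A set $E\subset\mathbb{R}^n$ is the union of closed $\rho$-balls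 ($\rho>0$) if for every $x\in E$ there exists $y\in\mathbb{R}^n$ such that $x\in\bar B(y;\rho)\subset E$. *)

theory Defs
  imports "HOL-Analysis.Analysis"
begin

(* Only meaningful for x \<in> S. *)
definition proximal_normal_cone :: "'a::euclidean_space set \<Rightarrow> 'a \<Rightarrow> 'a set" where
  "proximal_normal_cone S x =
     {\<zeta>. \<exists>\<sigma>\<ge>0. \<forall>s\<in>S. \<zeta> \<bullet> (s - x) \<le> \<sigma> * (norm (s - x))\<^sup>2}"

(* Only meaningful for nonzero \<zeta> \<in> proximal_normal_cone S x and r > 0. *)
definition realized_by_sphere :: "'a::euclidean_space set \<Rightarrow> 'a \<Rightarrow> 'a \<Rightarrow> real \<Rightarrow> bool" where
  "realized_by_sphere S x \<zeta> r \<longleftrightarrow> ball (x + r *\<^sub>R (\<zeta> /\<^sub>R norm \<zeta>)) r \<inter> S = {}"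

definition extended_exterior_sphere :: "'a::euclidean_space set \<Rightarrow> real \<Rightarrow> bool" where
  "extended_exterior_sphere S r \<longleftrightarrow>
     (\<forall>x\<in>frontier (interior S).
        \<exists>\<zeta>\<in>proximal_normal_cone S x. \<zeta> \<noteq> 0 \<and> realized_by_sphere S x \<zeta> r) \<and>
     (\<forall>x\<in>frontier S - frontier (interior S).
        \<forall>\<zeta>\<in>proximal_normal_cone S x. \<zeta> \<noteq> 0 \<longrightarrow> realized_by_sphere S x \<zeta> r)"

definition union_of_closed_balls :: "'a::euclidean_space set \<Rightarrow> real \<Rightarrow> bool" where
  "union_of_closed_balls E \<rho> \<longleftrightarrow> (\<forall>x\<in>E. \<exists>y. x \<in> cball y \<rho> \<and> cball y \<rho> \<subseteq> E)"

end

theory Submission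
  imports Defs
begin

text \<open>
  Let \<open>x \<notin> S\<close> and let \<open>c\<close> be a point of \<open>S\<close> nearest to \<open>x\<close>. Some unit vector \<open>\<zeta>\<close> realized by an
  \<open>r\<close>-sphere at \<open>c\<close> satisfies \<open>\<zeta> \<bullet> (x - c) \<ge> 0\<close>: if \<open>c\<close> is a limit of interior points of \<open>S\<close>, move
  these in the direction \<open>x - c\<close>; they leave the interior near \<open>c\<close>, and the normals given at
  the exit points accumulate at such a \<open>\<zeta>\<close>; otherwise the normalized \<open>x - c\<close> will do. Put \<open>p = c + r \<zeta>\<close>. If \<open>\<parallel>x - p\<parallel> < r\<close>, then \<open>x\<close> lies in an empty
  open \<open>r\<close>-ball. Otherwise, adding \<open>\<parallel>s - p\<parallel> \<ge> r\<close> and \<open>\<parallel>s - x\<parallel> \<ge> \<parallel>c - x\<parallel>\<close> shows that the open ball with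
  diameter \<open>[x, p]\<close>, of length at least \<open>r\<close>, misses \<open>S\<close>; it contains the required ball up to the
  tangency point \<open>x\<close>.
\<close>

text \<open>Expanding the squared distance from \<open>s\<close> to the center cancels
  \<open>r\<^sup>2\<close> and makes emptiness of the ball a quadratic inequality. In this form the
  condition can be tested at single points of \<open>S\<close> and passes directly to limits in the
  base point and the normal.\<close>

lemma realized_by_sphere_iff:
  assumes "r > 0" and "\<zeta> \<noteq> 0"
  shows "realized_by_sphere S x \<zeta> r \<longleftrightarrow>
    (\<forall>s\<in>S. 2 * r * (sgn \<zeta> \<bullet> (s - x)) \<le> (norm (s - x))\<^sup>2)"
proof -
  have *: "dist (x + r *\<^sub>R sgn \<zeta>) s < r \<longleftrightarrow> \<not> 2 * r * (sgn \<zeta> \<bullet> (s - x)) \<le> (norm (s - x))\<^sup>2" for s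
  proof -
    have n: "norm (sgn \<zeta>) = 1"
      using assms by (simp add: norm_sgn)
    have "dist (x + r *\<^sub>R sgn \<zeta>) s < r \<longleftrightarrow> (norm ((s - x) - r *\<^sub>R sgn \<zeta>))\<^sup>2 < r\<^sup>2"
      using \<open>r > 0\<close> power_strict_mono power2_less_imp_less
      by (metis diff_diff_eq dist_commute dist_norm less_imp_le norm_ge_zero pos2)
    also have "(norm ((s - x) - r *\<^sub>R sgn \<zeta>))\<^sup>2 =
        (norm (s - x))\<^sup>2 - 2 * r * (sgn \<zeta> \<bullet> (s - x)) + r\<^sup>2"
      using n unfolding norm_eq_1
      by (simp add: power2_norm_eq_inner inner_diff_left inner_diff_right inner_commute
          power2_eq_square[of r] algebra_simps)
    finally show ?thesis by auto
  qed
  show ?thesis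
    using * by (auto simp: realized_by_sphere_def sgn_div_norm ball_def)
qed

text \<open>Squaring the nearest-point inequality and cancelling the square of
  \<open>norm (x - c)\<close> leaves the proximal inequality with
  \<open>\<sigma> = 1/2\<close>.\<close>

lemma closest_point_proximal_normal:
  assumes "\<forall>s\<in>S. dist x c \<le> dist x s"
  shows "x - c \<in> proximal_normal_cone S c"
proof -
  have "(x - c) \<bullet> (s - c) \<le> 1/2 * (norm (s - c))\<^sup>2" if "s \<in> S" for s
  proof -
    have "(norm (x - c))\<^sup>2 \<le> (norm ((x - c) - (s - c)))\<^sup>2"
      using assms that by (simp add: dist_norm)
    then show ?thesis
      by (simp add: power2_norm_eq_inner inner_diff_left inner_diff_right inner_commute)
  qed
  then show ?thesis
    unfolding proximal_normal_cone_def by (intro CollectI exI[of _ "1/2"]) auto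
qed

text \<open>If \<open>c\<close> were interior, a short step from \<open>c\<close> toward
  \<open>x\<close> would stay in \<open>S\<close> and come strictly closer to
  \<open>x\<close>.\<close>

lemma closest_point_frontier:
  fixes S :: "'a::real_normed_vector set"
  assumes "c \<in> S" and "x \<notin> S" and near: "\<forall>s\<in>S. dist x c \<le> dist x s"
  shows "c \<in> frontier S"
proof (rule ccontr)
  assume "c \<notin> frontier S"
  with \<open>c \<in> S\<close> have "c \<in> interior S"
    by (auto simp: frontier_def closure_def)
  then obtain e where e: "e > 0" "ball c e \<subseteq> S"
    by (auto simp: mem_interior)
  have "x \<noteq> c" using assms by auto
  obtain t where t: "0 < t" "t < 1" "t * dist x c < e"
  proof
    show "0 < min (1/2) (e / (2 * dist x c))" "min (1/2) (e / (2 * dist x c)) < 1"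
      using e \<open>x \<noteq> c\<close> by auto
    have "min (1/2) (e / (2 * dist x c)) * dist x c \<le> e / (2 * dist x c) * dist x c"
      by (intro mult_right_mono) auto
    also have "\<dots> < e" using e \<open>x \<noteq> c\<close> by simp
    finally show "min (1/2) (e / (2 * dist x c)) * dist x c < e" .
  qed
  have "c + t *\<^sub>R (x - c) \<in> ball c e"
    using t by (simp add: dist_norm norm_minus_commute)
  then have "dist x c \<le> dist x (c + t *\<^sub>R (x - c))"
    using e near by blast
  also have "\<dots> = (1 - t) * dist x c"
  proof -
    have "x - (c + t *\<^sub>R (x - c)) = (1 - t) *\<^sub>R (x - c)"
      by (simp add: algebra_simps)
    then show ?thesis using t by (simp add: dist_norm)
  qed
  finally have "t * dist x c \<le> 0" by (simp add: algebra_simps)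
  then show False using t \<open>x \<noteq> c\<close> by (simp add: mult_le_0_iff)
qed

text \<open>An interior point \<open>z\<close> near \<open>c\<close> is pushed along
  \<open>x - c\<close> until it meets the frontier at \<open>p\<close>. Since \<open>z\<close> lies
  in \<open>S\<close> behind \<open>p\<close>, the sphere at \<open>p\<close> cannot point far
  backwards; \<open>e\<close> bounds both the displacement and the directional error.\<close>

lemma exists_realized_normal_approx:
  fixes S :: "'a::euclidean_space set"
  assumes "r > 0" and c: "c \<in> frontier (interior S)"
    and real: "\<forall>p\<in>frontier (interior S). \<exists>\<zeta>. \<zeta> \<noteq> 0 \<and> realized_by_sphere S p \<zeta> r"
    and "x \<notin> S" and "closed S" and near: "\<forall>s\<in>S. dist x c \<le> dist x s"
    and e: "0 < e" "e < 1"
  shows "\<exists>p \<zeta>. norm \<zeta> = 1 \<and> dist p c \<le> e + e * norm (x - c) \<and>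
    (\<forall>s\<in>S. 2 * r * (\<zeta> \<bullet> (s - p)) \<le> (norm (s - p))\<^sup>2) \<and>
    2 * r * (\<zeta> \<bullet> (x - c)) \<ge> - e * (norm (x - c))\<^sup>2"
proof -
  define v where "v = x - c"
  have "c \<in> closure (interior S)"
    using c by (simp add: frontier_def)
  then have "c \<in> S"
    using closure_minimal[OF interior_subset \<open>closed S\<close>] by blast
  then have "v \<noteq> 0" using \<open>x \<notin> S\<close> v_def by auto
  \<comment> \<open>This point is strictly nearer to \<open>x\<close> than \<open>c\<close> is. As
    the complement is open, the same shift applied to any start within \<open>d\<close> of
    \<open>c\<close> also ends outside \<open>S\<close>.\<close>
  have "c + e *\<^sub>R v \<notin> S"
  proof
    assume "c + e *\<^sub>R v \<in> S"
    then have "norm v \<le> dist x (c + e *\<^sub>R v)"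
      using near by (simp add: v_def dist_norm)
    also have "x - (c + e *\<^sub>R v) = (1 - e) *\<^sub>R v"
      by (simp add: v_def algebra_simps)
    then have "dist x (c + e *\<^sub>R v) = (1 - e) * norm v"
      using e by (simp add: dist_norm)
    finally have "e * norm v \<le> 0" by (simp add: algebra_simps)
    then show False using e \<open>v \<noteq> 0\<close> by (simp add: mult_le_0_iff)
  qed
  then obtain d where d: "d > 0" "ball (c + e *\<^sub>R v) d \<subseteq> - S"
    using \<open>closed S\<close> by (metis ComplI open_Compl open_contains_ball)
  obtain z where z: "z \<in> interior S" "dist z c < min d e"
    using \<open>c \<in> closure (interior S)\<close> d e unfolding closure_approachable
    by (metis min_less_iff_conj)
  have out: "z + e *\<^sub>R v \<notin> interior S"
  proof -
    have "z + e *\<^sub>R v \<in> ball (c + e *\<^sub>R v) d"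
      using z by (simp add: dist_norm norm_minus_commute)
    then show ?thesis using d interior_subset by blast
  qed
  have "closed_segment z (z + e *\<^sub>R v) \<inter> frontier (interior S) \<noteq> {}"
    using z out by (intro connected_Int_frontier) auto
  then obtain p where p: "p \<in> closed_segment z (z + e *\<^sub>R v)" "p \<in> frontier (interior S)"
    by blast
  then obtain u where u: "0 \<le> u" "u \<le> 1" "p = z + (u * e) *\<^sub>R v"
    by (auto simp: in_segment algebra_simps)
  define t where "t = u * e"
  \<comment> \<open>The open set \<open>interior S\<close> misses its frontier, so the displacement
    is nonzero and can be divided out below.\<close>
  have "p \<noteq> z" using p z by (auto simp: frontier_def)
  then have t: "0 < t" "t \<le> e" "p = z + t *\<^sub>R v"
    using u e by (auto simp: t_def mult_le_cancel_right1 order_less_le)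
  obtain \<zeta> where \<zeta>: "\<zeta> \<noteq> 0" "realized_by_sphere S p \<zeta> r"
    using real p by blast
  then have sph: "\<forall>s\<in>S. 2 * r * (sgn \<zeta> \<bullet> (s - p)) \<le> (norm (s - p))\<^sup>2"
    using realized_by_sphere_iff \<open>r > 0\<close> by blast
  have "z \<in> S" using z interior_subset by blast
  with sph have "2 * r * (sgn \<zeta> \<bullet> (z - p)) \<le> (norm (z - p))\<^sup>2"
    by blast
  then have "t * (- (2 * r * (sgn \<zeta> \<bullet> v))) \<le> t * (t * (norm v)\<^sup>2)"
    using t by (simp add: power2_eq_square algebra_simps)
  then have "- (2 * r * (sgn \<zeta> \<bullet> v)) \<le> t * (norm v)\<^sup>2"
    using t(1) by (rule mult_left_le_imp_le)
  also have "\<dots> \<le> e * (norm v)\<^sup>2"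
    using t by (intro mult_right_mono) auto
  finally have "2 * r * (sgn \<zeta> \<bullet> v) \<ge> - e * (norm v)\<^sup>2" by simp
  moreover have "dist p c \<le> e + e * norm v"
  proof -
    have "dist p c \<le> dist p z + dist z c" by (rule dist_triangle)
    also have "dist p z = t * norm v" using t by (simp add: dist_norm)
    also have "\<dots> \<le> e * norm v" using t by (intro mult_right_mono) auto
    finally show ?thesis using z by simp
  qed
  moreover have "norm (sgn \<zeta>) = 1" using \<zeta> by (simp add: norm_sgn)
  ultimately show ?thesis
    using sph unfolding v_def by blast
qed

text \<open>Compactness of the unit sphere yields a convergent subsequence of the approximate
  normals. The sphere inequality is continuous in normal and base point, and the directional error
  vanishes in the limit.\<close>

lemma exists_realized_normal_limit:
  fixes S :: "'a::euclidean_space set"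
  assumes "r > 0" and "c \<in> frontier (interior S)"
    and "\<forall>p\<in>frontier (interior S). \<exists>\<zeta>. \<zeta> \<noteq> 0 \<and> realized_by_sphere S p \<zeta> r"
    and "x \<notin> S" and "closed S" and "\<forall>s\<in>S. dist x c \<le> dist x s"
  shows "\<exists>\<zeta>. norm \<zeta> = 1 \<and> (\<forall>s\<in>S. 2 * r * (\<zeta> \<bullet> (s - c)) \<le> (norm (s - c))\<^sup>2) \<and>
    \<zeta> \<bullet> (x - c) \<ge> 0"
proof -
  \<comment> \<open>The shift by 2 keeps \<open>e n < 1\<close> even at
    \<open>n = 0\<close>.\<close>
  define e where "e n = 1 / real (n + 2)" for n
  have e: "0 < e n" "e n < 1" for n by (auto simp: e_def)
  have e0: "e \<longlonglongrightarrow> 0"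
    unfolding e_def by (rule LIMSEQ_ignore_initial_segment[OF lim_1_over_n])
  obtain P Z where Z: "norm (Z n) = 1"
    and P: "dist (P n) c \<le> e n + e n * norm (x - c)"
    and sph: "\<And>s. s \<in> S \<Longrightarrow> 2 * r * (Z n \<bullet> (s - P n)) \<le> (norm (s - P n))\<^sup>2"
    and dir: "2 * r * (Z n \<bullet> (x - c)) \<ge> - e n * (norm (x - c))\<^sup>2" for n
    using exists_realized_normal_approx[OF assms e] by metis
  have "(\<lambda>n. e n + e n * norm (x - c)) \<longlonglongrightarrow> 0 + 0 * norm (x - c)"
    by (rule tendsto_add[OF e0 tendsto_mult[OF e0 tendsto_const]])
  then have "(\<lambda>n. e n + e n * norm (x - c)) \<longlonglongrightarrow> 0"
    by simp
  moreover have "\<forall>n. norm (dist (P n) c) \<le> e n + e n * norm (x - c)"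
    using P by simp
  ultimately have "(\<lambda>n. dist (P n) c) \<longlonglongrightarrow> 0"
    by (rule Lim_null_comparison[OF always_eventually, rotated])
  then have Pc: "P \<longlonglongrightarrow> c"
    by (rule iffD2[OF tendsto_dist_iff])
  have "\<forall>n. Z n \<in> sphere 0 1"
    using Z by simp
  moreover have "seq_compact (sphere 0 1 :: 'a set)"
    by (simp add: compact_imp_seq_compact)
  ultimately obtain \<zeta> f where \<zeta>: "\<zeta> \<in> sphere 0 1" "strict_mono f" "(Z \<circ> f) \<longlonglongrightarrow> \<zeta>"
    by (metis seq_compactE)
  have Zf: "(\<lambda>n. Z (f n)) \<longlonglongrightarrow> \<zeta>" and Pf: "(\<lambda>n. P (f n)) \<longlonglongrightarrow> c" and ef: "(\<lambda>n. e (f n)) \<longlonglongrightarrow> 0"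
    using \<zeta> LIMSEQ_subseq_LIMSEQ[OF Pc] LIMSEQ_subseq_LIMSEQ[OF e0] by (auto simp: o_def)
  have "2 * r * (\<zeta> \<bullet> (s - c)) \<le> (norm (s - c))\<^sup>2" if "s \<in> S" for s
    by (rule LIMSEQ_le[of "\<lambda>n. 2 * r * (Z (f n) \<bullet> (s - P (f n)))" _
        "\<lambda>n. (norm (s - P (f n)))\<^sup>2"])
      (auto intro!: tendsto_intros Zf Pf sph that)
  moreover have "- 0 * (norm (x - c))\<^sup>2 \<le> 2 * r * (\<zeta> \<bullet> (x - c))"
  proof (rule LIMSEQ_le)
    show "(\<lambda>n. - e (f n) * (norm (x - c))\<^sup>2) \<longlonglongrightarrow> - 0 * (norm (x - c))\<^sup>2"
      by (intro tendsto_mult tendsto_minus tendsto_const ef)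
    show "(\<lambda>n. 2 * r * (Z (f n) \<bullet> (x - c))) \<longlonglongrightarrow> 2 * r * (\<zeta> \<bullet> (x - c))"
      by (intro tendsto_intros Zf)
  qed (use dir in blast)
  ultimately show ?thesis
    using \<zeta> \<open>r > 0\<close> by (intro exI[of _ \<zeta>]) (auto simp: zero_le_mult_iff)
qed

lemma exists_half_ball:
  fixes S :: "'a::euclidean_space set"
  assumes "r > 0" and "x \<notin> S" and "c \<in> S" and near: "\<forall>s\<in>S. dist x c \<le> dist x s"
    and \<zeta>: "norm \<zeta> = 1" "\<zeta> \<bullet> (x - c) \<ge> 0"
    and sph: "\<forall>s\<in>S. 2 * r * (\<zeta> \<bullet> (s - c)) \<le> (norm (s - c))\<^sup>2"
  shows "\<exists>y. x \<in> cball y (r / 2) \<and> cball y (r / 2) \<subseteq> - S"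
proof -
  define p where "p = c + r *\<^sub>R \<zeta>"
  have empty: "r \<le> dist p s" if "s \<in> S" for s
    using that sph \<zeta> realized_by_sphere_iff[OF \<open>r > 0\<close>, of \<zeta> S c]
    by (force simp: realized_by_sphere_def sgn_div_norm p_def ball_def)
  show ?thesis
  proof (cases "dist x p < r")
    case True
    \<comment> \<open>The midpoint is closer than \<open>r / 2\<close> to both ends, so its closed
      ball contains \<open>x\<close> and stays inside the open \<open>r\<close>-ball about
      \<open>p\<close>.\<close>
    define y where "y = midpoint x p"
    have y: "dist x y = dist x p / 2" "dist y p = dist x p / 2"
      by (simp_all add: y_def dist_midpoint)
    have "s \<notin> S" if "dist y s \<le> r / 2" for s
      using empty[of s] dist_triangle[of p s y] y True that by (auto simp: dist_commute)
    then have "cball y (r / 2) \<subseteq> - S" by auto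
    moreover have "x \<in> cball y (r / 2)" using y True by (simp add: dist_commute)
    ultimately show ?thesis by blast
  next
    case False
    define q where "q = p - x"
    have q: "norm q \<ge> r" using False by (simp add: q_def dist_norm norm_minus_commute)
    \<comment> \<open>The center sits at distance \<open>r / 2\<close> from \<open>x\<close> toward
      \<open>p\<close>, which puts \<open>x\<close> on the boundary of the new ball.\<close>
    define y where "y = x + (r / 2) *\<^sub>R sgn q"
    have nq: "norm (sgn q) = 1" using q \<open>r > 0\<close> by (auto simp: norm_sgn)
    have "norm (s - y) > r / 2" if "s \<in> S" for s
    proof -
      define w where "w = s - x"
      have w: "w \<noteq> 0" using that \<open>x \<notin> S\<close> by (auto simp: w_def)
      define a where "a = x - c"
      have a: "a \<noteq> 0" using \<open>c \<in> S\<close> \<open>x \<notin> S\<close> by (auto simp: a_def)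
      have "norm a \<le> norm w"
        using near that by (simp add: a_def w_def dist_norm norm_minus_commute)
      then have aw: "a \<bullet> a \<le> w \<bullet> w"
        by (simp add: norm_le)
      have q_eq: "q = r *\<^sub>R \<zeta> - a" by (simp add: q_def p_def a_def)
      have z1: "\<zeta> \<bullet> \<zeta> = 1" using \<zeta> by (simp add: norm_eq_1)
      have "2 * r * (\<zeta> \<bullet> (w + a)) \<le> (norm (w + a))\<^sup>2"
        using sph that by (simp add: w_def a_def)
      then have s1: "2 * r * (\<zeta> \<bullet> w) + 2 * r * (\<zeta> \<bullet> a) \<le> w \<bullet> w + 2 * (a \<bullet> w) + a \<bullet> a"
        by (simp add: power2_norm_eq_inner inner_add_left inner_add_right inner_commute algebra_simps)
      \<comment> \<open>Half the sum of \<open>s1\<close> and \<open>aw\<close>. Since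
        \<open>r * (\<zeta> \<bullet> a)\<close> is nonnegative, it places \<open>s\<close> outside
        the open ball with diameter from \<open>x\<close> to \<open>p\<close>.\<close>
      have wq: "w \<bullet> q + r * (\<zeta> \<bullet> a) \<le> w \<bullet> w"
        using s1 aw by (simp add: q_eq inner_diff_right inner_commute)
      have ra: "r * (\<zeta> \<bullet> a) \<ge> 0" using \<zeta> \<open>r > 0\<close> by (simp add: a_def)
      have qq: "q \<bullet> q = r\<^sup>2 - 2 * (r * (\<zeta> \<bullet> a)) + a \<bullet> a"
        using z1 by (simp add: q_eq inner_diff_left inner_diff_right inner_commute power2_eq_square)
      \<comment> \<open>This is the goal squared and expanded. Strictness is essential because the
        ball to be avoided is closed.\<close>
      have "r * (w \<bullet> sgn q) < w \<bullet> w"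
      proof (cases "w \<bullet> q \<le> 0")
        case True
        then have "r * (w \<bullet> sgn q) \<le> 0"
          using \<open>r > 0\<close> by (simp add: sgn_div_norm mult_nonneg_nonpos)
        also have "0 < w \<bullet> w" using w by simp
        finally show ?thesis .
      next
        case pos: False
        have eq: "r * (w \<bullet> sgn q) = (r / norm q) * (w \<bullet> q)"
          by (simp add: sgn_div_norm field_simps)
        show ?thesis
        \<comment> \<open>If \<open>norm q = r\<close>, the factor \<open>r / norm q\<close> gives
          no slack; instead \<open>qq\<close> gives
          \<open>2 * (r * (\<zeta> \<bullet> a)) = a \<bullet> a > 0\<close>, which makes
          \<open>wq\<close> strict.\<close>
        proof (cases "norm q = r")
          case True
          then have "q \<bullet> q = r\<^sup>2" by (metis power2_norm_eq_inner)
          moreover have "a \<bullet> a > 0" using a by simp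
          ultimately have "r * (\<zeta> \<bullet> a) > 0" using qq by linarith
          then show ?thesis using wq eq True \<open>r > 0\<close> by simp
        next
          case False
          then have "r / norm q < 1" using q \<open>r > 0\<close> by (simp add: divide_less_eq)
          then have "(r / norm q) * (w \<bullet> q) < 1 * (w \<bullet> q)"
            using pos by (intro mult_strict_right_mono) auto
          then show ?thesis using wq ra eq by simp
        qed
      qed
      moreover have "(norm (s - y))\<^sup>2 = w \<bullet> w - r * (w \<bullet> sgn q) + (r / 2)\<^sup>2"
      proof -
        have "s - y = w - (r / 2) *\<^sub>R sgn q" by (simp add: w_def y_def)
        moreover have "sgn q \<bullet> sgn q = 1" using nq by (simp add: norm_eq_1)
        ultimately show ?thesis
          by (simp add: power2_norm_eq_inner inner_diff_left inner_diff_right inner_commute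
              power2_eq_square[of r] power_divide)
      qed
      ultimately have "(r / 2)\<^sup>2 < (norm (s - y))\<^sup>2" by simp
      then show ?thesis by (rule power2_less_imp_less) simp
    qed
    then have "cball y (r / 2) \<subseteq> - S"
      by (force simp: dist_norm norm_minus_commute)
    moreover have "x \<in> cball y (r / 2)"
      using nq \<open>r > 0\<close> by (simp add: y_def dist_norm)
    ultimately show ?thesis by blast
  qed
qed

theorem theorem1p2:
  fixes S :: "(real ^ 'n) set" and r :: real
  assumes "closed S" and "r > 0" and "extended_exterior_sphere S r"
  shows "union_of_closed_balls (- S) (r / 2)"
  unfolding union_of_closed_balls_def
proof
  fix x assume "x \<in> - S"
  then have x: "x \<notin> S" by simp
  show "\<exists>y. x \<in> cball y (r / 2) \<and> cball y (r / 2) \<subseteq> - S"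
  proof (cases "S = {}")
    case True
    then have "x \<in> cball x (r / 2) \<and> cball x (r / 2) \<subseteq> - S"
      using \<open>r > 0\<close> by simp
    then show ?thesis by blast
  next
    case False
    then obtain c where c: "c \<in> S" "\<forall>s\<in>S. dist x c \<le> dist x s"
      using distance_attains_inf[OF \<open>closed S\<close>, of x] by metis
    have "\<exists>\<zeta>. norm \<zeta> = 1 \<and> (\<forall>s\<in>S. 2 * r * (\<zeta> \<bullet> (s - c)) \<le> (norm (s - c))\<^sup>2) \<and>
      \<zeta> \<bullet> (x - c) \<ge> 0"
    \<comment> \<open>On the frontier of the interior only some normal is realized, with no control
      of its direction, so the limit argument is used. Elsewhere every nonzero proximal normal is
      realized, in particular \<open>x - c\<close>.\<close>
    proof (cases "c \<in> frontier (interior S)")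
      case True
      moreover have "\<forall>p\<in>frontier (interior S). \<exists>\<zeta>. \<zeta> \<noteq> 0 \<and> realized_by_sphere S p \<zeta> r"
        using assms(3) unfolding extended_exterior_sphere_def by blast
      ultimately show ?thesis
        using exists_realized_normal_limit \<open>r > 0\<close> x \<open>closed S\<close> c(2) by blast
    next
      case False
      then have "c \<in> frontier S - frontier (interior S)"
        using closest_point_frontier c x by blast
      moreover have "x - c \<noteq> 0" using c x by auto
      ultimately have "realized_by_sphere S c (x - c) r"
        using assms(3) closest_point_proximal_normal[OF c(2)]
        unfolding extended_exterior_sphere_def by blast
      then show ?thesis
        using realized_by_sphere_iff[OF \<open>r > 0\<close> \<open>x - c \<noteq> 0\<close>] \<open>x - c \<noteq> 0\<close>
        by (intro exI[of _ "sgn (x - c)"]) (auto simp: norm_sgn sgn_div_norm)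
    qed
    then show ?thesis
      using exists_half_ball[OF \<open>r > 0\<close> x c] by blast
  qed
qed

end
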